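(* Let $\mathcal{R}$ be a subring of $\mathbb{R}$, $\mathcal{G}\subseteq\mathbb{R}^n$ a sub-module of the $\mathcal{R}$-module $\mathbb{R}^n$, and $\mathcal{C}_\rho=\{(\vec v_k,w_k)\}_{k=1}^m$ a restricted chamfer mask. Let $\mathcal{F}=(\vec v_{i_1},\dots,\vec v_{i_n})$ generate a wedge of $\mathcal{C}_\rho$ (of its organization in $\mathcal{G}$-basis wedges) and let $p$ be a point of $\mathcal{G}$ lying in this wedge. Then $$d_{\mathcal{C}_\rho}(p)=\frac{1}{\Delta^0_{\mathcal{F}}}\sum_{k=1}^n\Delta^k_{\mathcal{F}}(p)\,w_{i_k}.$$
   Context: A sub-module of the $\mathcal{R}$-module $\mathbb{R}^n$ is an additive subgroup of $\mathbb{R}^n$ closed under multiplication by elements of $\mathcal{R}$; points and vectors are identified, origin $O=0$, coordinates in the canonical basis. A basis of $(\mathcal{G},\mathcal{R})$ is a family of $n$ vectors of $\mathcal{G}$, linearly independent over $\mathcal{R}$, such that every element of $\mathcal{G}$ is an $\mathcal{R}$-linear combination of them. For $\mathcal{F}=(\vec u_1,\dots,\vec u_n)$: $\Delta^0_{\mathcal{F}}=\det(\vec u_1,\dots,\vec u_n)$ and $\Delta^k_{\mathcal{F}}(\vec x)=\det(\vec u_1,\dots,\vec u_{k-1},\vec x,\vec u_{k+1},\dots,\vec u_n)$. For a finite set $\mathcal{C}=\{(\vec v_k,w_k)\}\subseteq\mathcal{G}\times\mathcal{R}$: a path from $p$ to $q$ is given by coefficients $\alpha_k\in\mathcal{R}$,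 $\alpha_k\ge0$, with $\sum_k\alpha_k\vec v_k=q-p$, of cost $\sum_k\alpha_kw_k$; $d_{\mathcal{C}}(p,q)$ is the minimum cost of such paths and $d_{\mathcal{C}}(p)=d_{\mathcal{C}}(O,p)$. The $\mathcal{G}$-sector $\langle\langle\vec u_1,\dots,\vec u_n\rangle\rangle$ of independent vectors is the set of points of $\mathcal{G}$ equal to $\sum_k\lambda_k\vec u_k$ with real $\lambda_k\ge0$; a wedge of $\mathcal{C}$ is such a sector generated by $n$ vectors of $\mathcal{C}$ and containing no other vector of $\mathcal{C}$. A restricted chamfer mask is a finite set $\mathcal{C}_\rho=\{(\vec v_k,w_k)\}_{k=1}^m\subseteq\mathcal{G}\times\mathcal{R}$ such that: (1) $w_k>0$ and $\vec v_k\ne0$ for all $k$; (2) $(\vec v,w)\in\mathcal{C}_\rho\Rightarrow(-\vec v,w)\in\mathcal{C}_\rho$; (3) it is organized in $\mathcal{G}$-basis wedges: its vectors are arranged into a collection of wedges whose generators each form a basis of $(\mathcal{G},\mathcal{R})$, and every $p\in\mathcal{G}$ can be written $p=\sum_{k=1}^n\alpha_k\vec v_{i_k}$ with $\alpha_k\in\mathcal{R}$, $\alpha_k\ge0$, for the generators of some wedge; (4) the normalized chamfer mask polytope $\mathcal{B}_{\mathcal{C}_\rho}$ — the polytope whose faces are the $(n-1)$-simplices with vertices $\frac{1}{w_{i_1}}\vec v_{i_1},\dots,\frac{1}{w_{i_n}}\vec v_{i_n}$, one per wedge — is convex, i.e. equals its convex hull. *)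

theory Defs
  imports "HOL-Analysis.Analysis"
begin

definition real_subring :: "real set \<Rightarrow> bool" where
  "real_subring R \<longleftrightarrow> 1 \<in> R \<and> (\<forall>a\<in>R. \<forall>b\<in>R. a - b \<in> R \<and> a * b \<in> R)"

definition submodule_over :: "real set \<Rightarrow> (real ^ 'n) set \<Rightarrow> bool" where
  "submodule_over R G \<longleftrightarrow>
     0 \<in> G \<and> (\<forall>x\<in>G. \<forall>y\<in>G. x - y \<in> G) \<and> (\<forall>a\<in>R. \<forall>x\<in>G. a *\<^sub>R x \<in> G)"

text \<open>Families of \<open>n\<close> vectors are functions on the index type \<open>'n\<close>, with \<open>n = CARD('n)\<close>.\<close>

definition module_basis :: "real set \<Rightarrow> (real ^ 'n) set \<Rightarrow> ('n \<Rightarrow> real ^ 'n) \<Rightarrow> bool" where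
  "module_basis R G u \<longleftrightarrow>
     range u \<subseteq> G \<and>
     (\<forall>a. range a \<subseteq> R \<and> (\<Sum>k\<in>UNIV. a k *\<^sub>R u k) = 0 \<longrightarrow> (\<forall>k. a k = 0)) \<and>
     (\<forall>x\<in>G. \<exists>a. range a \<subseteq> R \<and> x = (\<Sum>k\<in>UNIV. a k *\<^sub>R u k))"

definition Delta0 :: "('n \<Rightarrow> real ^ 'n) \<Rightarrow> real" where
  "Delta0 u = det (\<chi> i j. u j $ i)"

definition Delta :: "('n \<Rightarrow> real ^ 'n) \<Rightarrow> 'n \<Rightarrow> real ^ 'n \<Rightarrow> real" where
  "Delta u k x = Delta0 (u(k := x))"

text \<open>A path assigns a coefficient to each weighted vector of the finite set \<open>C\<close>.\<close>

definition is_path ::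
  "real set \<Rightarrow> ((real ^ 'n) \<times> real) set \<Rightarrow> real ^ 'n \<Rightarrow> real ^ 'n \<Rightarrow> ((real ^ 'n) \<times> real \<Rightarrow> real) \<Rightarrow> bool"
  where
  "is_path R C p q \<alpha> \<longleftrightarrow>
     (\<forall>c\<in>C. \<alpha> c \<in> R \<and> 0 \<le> \<alpha> c) \<and> (\<Sum>c\<in>C. \<alpha> c *\<^sub>R fst c) = q - p"

definition path_cost :: "((real ^ 'n) \<times> real) set \<Rightarrow> ((real ^ 'n) \<times> real \<Rightarrow> real) \<Rightarrow> real" where
  "path_cost C \<alpha> = (\<Sum>c\<in>C. \<alpha> c * snd c)"

text \<open>\<open>LEAST\<close> rather than \<open>Inf\<close>: the distance is an attained minimum, and its value is
  unspecified if no path of minimal cost exists.\<close>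

definition chamfer_dist ::
  "real set \<Rightarrow> ((real ^ 'n) \<times> real) set \<Rightarrow> real ^ 'n \<Rightarrow> real ^ 'n \<Rightarrow> real" where
  "chamfer_dist R C p q = (LEAST c. \<exists>\<alpha>. is_path R C p q \<alpha> \<and> c = path_cost C \<alpha>)"

definition chamfer_norm :: "real set \<Rightarrow> ((real ^ 'n) \<times> real) set \<Rightarrow> real ^ 'n \<Rightarrow> real" where
  "chamfer_norm R C p = chamfer_dist R C 0 p"

definition sector :: "(real ^ 'n) set \<Rightarrow> ('n \<Rightarrow> real ^ 'n) \<Rightarrow> (real ^ 'n) set" where
  "sector G u = {p \<in> G. \<exists>l. (\<forall>k. 0 \<le> l k) \<and> p = (\<Sum>k\<in>UNIV. l k *\<^sub>R u k)}"

text \<open>\<open>F\<close> lists the weighted vectors whose vectors generate the wedge. The elements of \<open>C\<close> are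
  the weighted vectors, so an element \<open>(v, w')\<close> of \<open>C\<close> counts as other than \<open>(v, w)\<close> if
  \<open>w' \<noteq> w\<close>. Independence of the generators is over the reals, as the sector has real
  coefficients.\<close>

definition is_wedge ::
  "(real ^ 'n) set \<Rightarrow> ((real ^ 'n) \<times> real) set \<Rightarrow> ('n \<Rightarrow> (real ^ 'n) \<times> real) \<Rightarrow> bool" where
  "is_wedge G C F \<longleftrightarrow>
     range F \<subseteq> C \<and>
     inj (fst \<circ> F) \<and> independent (range (fst \<circ> F)) \<and>
     (\<forall>c\<in>C. fst c \<in> sector G (fst \<circ> F) \<longrightarrow> c \<in> range F)"

definition basis_wedge_organization ::
  "real set \<Rightarrow> (real ^ 'n) set \<Rightarrow> ((real ^ 'n) \<times> real) set \<Rightarrow> ('n \<Rightarrow> (real ^ 'n) \<times> real) set \<Rightarrow> bool"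
  where
  "basis_wedge_organization R G C W \<longleftrightarrow>
     (\<forall>F\<in>W. is_wedge G C F \<and> module_basis R G (fst \<circ> F)) \<and>
     C = (\<Union>F\<in>W. range F) \<and>
     (\<forall>p\<in>G. \<exists>F\<in>W. \<exists>a. (\<forall>k. a k \<in> R \<and> 0 \<le> a k) \<and> p = (\<Sum>k\<in>UNIV. a k *\<^sub>R fst (F k)))"

definition normalized_vertices :: "('n \<Rightarrow> (real ^ 'n) \<times> real) \<Rightarrow> (real ^ 'n) set" where
  "normalized_vertices F = range (\<lambda>k. (1 / snd (F k)) *\<^sub>R fst (F k))"

definition normalized_simplex :: "('n \<Rightarrow> (real ^ 'n) \<times> real) \<Rightarrow> (real ^ 'n) set" where
  "normalized_simplex F = convex hull (normalized_vertices F)"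

text \<open>The solid body that the simplices enclose: the union of the pyramids over them with apex
  at the origin.\<close>

definition normalized_polytope :: "('n \<Rightarrow> (real ^ 'n) \<times> real) set \<Rightarrow> (real ^ 'n) set" where
  "normalized_polytope W = (\<Union>F\<in>W. convex hull (insert 0 (normalized_vertices F)))"

text \<open>The frontier equation says that the simplices are the faces of the polytope. It is stated
  for their union since neighbouring simplices may be coplanar, and then are not facets in
  the sense of \<open>facet_of\<close>. Without it, simplices of overlapping wedges could lie inside the
  body.\<close>

definition restricted_chamfer_mask ::
  "real set \<Rightarrow> (real ^ 'n) set \<Rightarrow> ((real ^ 'n) \<times> real) set \<Rightarrow> ('n \<Rightarrow> (real ^ 'n) \<times> real) set \<Rightarrow> bool"
  where
  "restricted_chamfer_mask R G C W \<longleftrightarrow>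
     finite C \<and> C \<subseteq> G \<times> R \<and>
     (\<forall>(v, w)\<in>C. 0 < w \<and> v \<noteq> 0) \<and>
     (\<forall>(v, w)\<in>C. (- v, w) \<in> C) \<and>
     basis_wedge_organization R G C W \<and>
     frontier (normalized_polytope W) = (\<Union>F\<in>W. normalized_simplex F) \<and>
     convex (normalized_polytope W)"

end

theory Submission
  imports Defs
begin

text \<open>
  Since the simplex of \<open>F\<close> lies on the frontier of the convex body, a hyperplane supports the
  body at the barycentre of the simplex, hence contains all its vertices. As these are linearly
  independent, the hyperplane avoids the origin and can be written \<open>f = 1\<close> for a linear
  functional \<open>f\<close>. Then \<open>f v = w\<close> for the generators of the wedge and \<open>f v \<le> w\<close> for every
  element \<open>(v, w)\<close> of the mask, so each path to \<open>p\<close> costs at least \<open>f p\<close>. The path along the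
  generators attains this bound, and Cramer's rule computes its coefficients.
\<close>

text \<open>If \<open>S\<close> has empty interior, it lies in a hyperplane, which also contains its
  closure. Otherwise \<open>b\<close> is separated from the interior, and the inequality passes to
  \<open>S\<close> because a convex set with interior points lies in the closure of its
  interior.\<close>

lemma supporting_hyperplane_frontier:
  fixes S :: "'a::euclidean_space set"
  assumes "convex S" and "b \<in> frontier S"
  obtains a where "a \<noteq> 0" and "\<And>x. x \<in> S \<Longrightarrow> a \<bullet> x \<le> a \<bullet> b"
proof (cases "interior S = {}")
  case True
  then obtain a c where a: "a \<noteq> 0" "S \<subseteq> {x. a \<bullet> x = c}"
    using empty_interior_subset_hyperplane[OF \<open>convex S\<close>] by metis
  have "closure S \<subseteq> {x. a \<bullet> x = c}"
    using a(2) by (intro closure_minimal closed_hyperplane)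
  moreover have "b \<in> closure S"
    using assms(2) by (simp add: frontier_def)
  ultimately have b: "a \<bullet> b = c"
    by blast
  show ?thesis
  proof
    show "a \<bullet> x \<le> a \<bullet> b" if "x \<in> S" for x
      using subsetD[OF a(2) that] b by simp
  qed (fact a(1))
next
  case False
  have "b \<notin> interior S"
    using assms(2) by (simp add: frontier_def)
  then obtain a c where a: "a \<noteq> 0" "\<forall>x\<in>interior S. a \<bullet> x \<le> c" "a \<bullet> b \<ge> c"
    using separating_hyperplane_sets[of "interior S" "{b}"] False assms(1)
    by (auto simp: convex_interior)
  have "closure (interior S) \<subseteq> {x. a \<bullet> x \<le> c}"
    using a(2) by (intro closure_minimal closed_halfspace_le) auto
  moreover have "S \<subseteq> closure (interior S)"
    using convex_closure_interior[OF assms(1) False] closure_subset by auto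
  ultimately show ?thesis
    using that[of a] a(1,3) by force
qed

lemma independent_family_unique:
  fixes u :: "'i::finite \<Rightarrow> 'v::real_vector"
  assumes "inj u" and "independent (range u)"
    and "(\<Sum>k\<in>UNIV. a k *\<^sub>R u k) = (\<Sum>k\<in>UNIV. b k *\<^sub>R u k)"
  shows "a = b"
proof
  fix k
  \<comment> \<open>Independence concerns a set of vectors, so the coefficients are moved from
    indices to vectors along the injection \<open>u\<close>.\<close>
  let ?c = "\<lambda>v. a (inv u v) - b (inv u v)"
  have "(\<Sum>v\<in>range u. ?c v *\<^sub>R v) = (\<Sum>k\<in>UNIV. (a k - b k) *\<^sub>R u k)"
    using assms(1) by (simp add: sum.reindex)
  also have "\<dots> = 0"
    using assms(3) by (simp add: scaleR_left_diff_distrib sum_subtractf)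
  finally have "?c (u k) = 0"
    using independentD[OF assms(2), of "range u" ?c "u k"] by simp
  then show "a k = b k"
    using assms(1) by simp
qed

lemma column_matrix_mult:
  fixes u :: "'n::finite \<Rightarrow> real ^ 'n"
  shows "(\<chi> i j. u j $ i) *v (\<chi> k. a k) = (\<Sum>k\<in>UNIV. a k *\<^sub>R u k)"
  by (simp add: vec_eq_iff matrix_vector_mult_def mult.commute)

text \<open>Cramer's rule in division-free form: with the \<open>u j\<close> as columns, the sum is
  the matrix applied to the coefficient vector.\<close>

lemma Delta_sum:
  fixes u :: "'n::finite \<Rightarrow> real ^ 'n"
  shows "Delta u k (\<Sum>j\<in>UNIV. a j *\<^sub>R u j) = a k * Delta0 u"
proof -
  let ?A = "\<chi> i j. u j $ i" and ?x = "\<chi> k. a k"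
  have "Delta u k (\<Sum>j\<in>UNIV. a j *\<^sub>R u j)
      = det (\<chi> i j. if j = k then (?A *v ?x) $ i else ?A $ i $ j)"
    unfolding Delta_def Delta0_def column_matrix_mult
    by (rule arg_cong[where f = det]) (simp add: vec_eq_iff)
  also have "\<dots> = ?x $ k * det ?A"
    by (rule cramer_lemma)
  finally show ?thesis
    by (simp add: Delta0_def)
qed

lemma Delta0_nonzero:
  fixes u :: "'n::finite \<Rightarrow> real ^ 'n"
  assumes "inj u" and "independent (range u)"
  shows "Delta0 u \<noteq> 0"
proof -
  let ?A = "\<chi> i j. u j $ i"
  have "inj ((*v) ?A)"
  proof (rule injI)
    fix x y assume "?A *v x = ?A *v y"
    \<comment> \<open>Eta-expansion turns both products into linear combinations of the
      columns.\<close>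
    then have "?A *v (\<chi> k. x $ k) = ?A *v (\<chi> k. y $ k)"
      by simp
    then have "($) x = ($) y"
      unfolding column_matrix_mult by (rule independent_family_unique[OF assms])
    then show "x = y"
      by (simp add: vec_eq_iff)
  qed
  then show ?thesis
    using det_nz_iff_inj[of "(*v) ?A"] by (simp add: Delta0_def)
qed

text \<open>In terms of linear programming, \<open>a\<close> is a feasible dual solution for the
  minimal cost problem, with all constraints of the wedge \<open>F\<close> tight.\<close>

lemma mask_supporting_functional:
  fixes F :: "'n::finite \<Rightarrow> (real ^ 'n) \<times> real"
  assumes mask: "restricted_chamfer_mask R G C W" and F: "F \<in> W"
  obtains a where "\<And>k. a \<bullet> fst (F k) = snd (F k)"
    and "\<And>c. c \<in> C \<Longrightarrow> a \<bullet> fst c \<le> snd c"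
proof -
  let ?P = "normalized_polytope W"
  let ?x = "\<lambda>F k. (1 / snd (F k)) *\<^sub>R fst (F k) :: real ^ 'n"
  let ?n = "real CARD('n)"
  have pos: "snd c > 0" if "c \<in> C" for c
    using mask that by (auto simp: restricted_chamfer_mask_def)
  have org: "basis_wedge_organization R G C W"
    using mask by (simp add: restricted_chamfer_mask_def)
  then have C: "C = (\<Union>F\<in>W. range F)"
    by (simp add: basis_wedge_organization_def)
  have indep: "inj (fst \<circ> F)" "independent (range (fst \<circ> F))"
    using org F by (auto simp: basis_wedge_organization_def is_wedge_def)
  have FC: "F k \<in> C" for k
    using C F by blast
  have xP: "?x F' k \<in> ?P" if "F' \<in> W" for F' k
    using that unfolding normalized_polytope_def normalized_vertices_def
    by (blast intro: hull_inc)
  have "0 \<in> ?P"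
    using F unfolding normalized_polytope_def by (blast intro: hull_inc)
  \<comment> \<open>All weights of the barycentre are positive, so a functional that is maximal on
    the body at \<open>b\<close> is maximal at every vertex of the simplex.\<close>
  define b where "b = (\<Sum>k\<in>UNIV. (1 / ?n) *\<^sub>R ?x F k)"
  have "b \<in> normalized_simplex F"
    unfolding b_def normalized_simplex_def
    by (rule convex_sum) (auto simp: normalized_vertices_def intro: hull_inc)
  then have bP: "b \<in> frontier ?P"
    using mask F by (auto simp: restricted_chamfer_mask_def)
  have "convex ?P"
    using mask by (simp add: restricted_chamfer_mask_def)
  then obtain a where a: "a \<noteq> 0" "\<And>x. x \<in> ?P \<Longrightarrow> a \<bullet> x \<le> a \<bullet> b"
    using bP by (rule supporting_hyperplane_frontier) blast
  have vertex: "a \<bullet> ?x F k = a \<bullet> b" for k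
  proof -
    have "(\<Sum>k\<in>UNIV. a \<bullet> b - a \<bullet> ?x F k) = ?n * (a \<bullet> b) - (\<Sum>k\<in>UNIV. a \<bullet> ?x F k)"
      by (simp add: sum_subtractf)
    also have "(\<Sum>k\<in>UNIV. a \<bullet> ?x F k) = ?n * (a \<bullet> b)"
      unfolding b_def by (simp add: inner_sum_right sum_distrib_left)
    finally have "(\<Sum>k\<in>UNIV. a \<bullet> b - a \<bullet> ?x F k) = 0"
      by simp
    then have "\<forall>k\<in>UNIV. a \<bullet> b - a \<bullet> ?x F k = 0"
      using a(2)[OF xP[OF F]] by (subst (asm) sum_nonneg_eq_0_iff) simp_all
    then show ?thesis by simp
  qed
  have generator: "a \<bullet> fst (F k) = (a \<bullet> b) * snd (F k)" for k
    using vertex[of k] pos[OF FC[of k]] by (simp add: field_simps)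
  have "a \<bullet> b \<noteq> 0"
  proof
    assume "a \<bullet> b = 0"
    then have orth: "orthogonal a x" if "x \<in> range (fst \<circ> F)" for x
      using that generator by (auto simp: orthogonal_def)
    \<comment> \<open>The \<open>n\<close> independent generators span the space, so
      \<open>a\<close> would be orthogonal to itself.\<close>
    have "card (range (fst \<circ> F)) = CARD('n)"
      using indep(1) by (rule card_image)
    then have "a \<in> span (range (fst \<circ> F))"
      using card_ge_dim_independent[OF subset_UNIV indep(2)] by (simp add: subset_iff del: comp_apply)
    then have "orthogonal a a"
      using orth by (rule orthogonal_to_span)
    then show False
      using a(1) by (simp add: orthogonal_def)
  qed
  \<comment> \<open>The origin, as apex of the pyramids, fixes the sign.\<close>
  moreover have "0 \<le> a \<bullet> b"
    using a(2)[OF \<open>0 \<in> ?P\<close>] by simp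
  ultimately have ab: "a \<bullet> b > 0"
    by simp
  show ?thesis
  proof
    show "((1 / (a \<bullet> b)) *\<^sub>R a) \<bullet> fst (F k) = snd (F k)" for k
      using generator[of k] ab by simp
    show "((1 / (a \<bullet> b)) *\<^sub>R a) \<bullet> fst c \<le> snd c" if c: "c \<in> C" for c
    proof -
      \<comment> \<open>Every mask element generates some wedge, so its normalized vector lies in
        the body.\<close>
      obtain F' k where "F' \<in> W" "c = F' k"
        using C c by blast
      then have "a \<bullet> ((1 / snd c) *\<^sub>R fst c) \<le> a \<bullet> b"
        using a(2)[OF xP] by blast
      then show ?thesis
        using ab pos[OF c] by (simp add: field_simps)
    qed
  qed
qed

theorem theorem2p2:
  fixes R :: "real set" and G :: "(real ^ 'n) set"
    and C :: "((real ^ 'n) \<times> real) set" and W :: "('n \<Rightarrow> (real ^ 'n) \<times> real) set"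
    and F :: "'n \<Rightarrow> (real ^ 'n) \<times> real" and p :: "real ^ 'n"
  assumes "real_subring R"
    and "submodule_over R G"
    and "restricted_chamfer_mask R G C W"
    and "F \<in> W"
    and "p \<in> sector G (fst \<circ> F)"
  shows "chamfer_norm R C p =
    1 / Delta0 (fst \<circ> F) * (\<Sum>k\<in>UNIV. Delta (fst \<circ> F) k p * snd (F k))"
proof -
  let ?u = "fst \<circ> F"
  have finC: "finite C" and org: "basis_wedge_organization R G C W"
    using assms(3) by (simp_all add: restricted_chamfer_mask_def)
  have indep: "inj ?u" "independent (range ?u)" and basis: "module_basis R G ?u"
    and FC: "range F \<subseteq> C"
    using org assms(4) by (auto simp: basis_wedge_organization_def is_wedge_def)
  have injF: "inj F"
    using indep(1) by (rule inj_on_imageI2)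
  obtain l where l: "\<forall>k. 0 \<le> l k" "p = (\<Sum>k\<in>UNIV. l k *\<^sub>R ?u k)" and "p \<in> G"
    using assms(5) by (auto simp: sector_def)
  then obtain l' where l': "range l' \<subseteq> R" "p = (\<Sum>k\<in>UNIV. l' k *\<^sub>R ?u k)"
    using basis unfolding module_basis_def by blast
  \<comment> \<open>The sector provides nonnegative real coefficients, the module basis coefficients
    in \<open>R\<close>; independence over the reals identifies them.\<close>
  have "l' = l"
    using l(2) l'(2) by (intro independent_family_unique[OF indep]) simp
  then have lR: "l k \<in> R" for k
    using l'(1) by blast
  have "1 - 1 \<in> R"
    using assms(1) unfolding real_subring_def by blast
  then have "0 \<in> R"
    by simp
  obtain a where a: "\<And>k. a \<bullet> fst (F k) = snd (F k)" "\<And>c. c \<in> C \<Longrightarrow> a \<bullet> fst c \<le> snd c"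
    using mask_supporting_functional[OF assms(3,4)] by blast
  have ap: "a \<bullet> p = (\<Sum>k\<in>UNIV. l k * snd (F k))"
    by (simp add: l(2) inner_sum_right a(1))
  \<comment> \<open>A path has a coefficient for every mask element; those outside the wedge get 0,
    which is why \<open>0 \<in> R\<close> matters.\<close>
  define \<alpha> where "\<alpha> c = (if c \<in> range F then l (inv F c) else 0)" for c
  have \<alpha>_F: "\<alpha> (F k) = l k" for k
    by (simp add: \<alpha>_def injF)
  have sum_C: "(\<Sum>c\<in>C. f c) = (\<Sum>k\<in>UNIV. f (F k))"
    if "\<And>c. c \<notin> range F \<Longrightarrow> f c = 0" for f :: "(real ^ 'n) \<times> real \<Rightarrow> 'b::comm_monoid_add"
  proof -
    have "sum f C = sum f (range F)"
      using finC FC that by (intro sum.mono_neutral_right) auto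
    then show ?thesis
      using injF by (simp add: sum.reindex)
  qed
  have path: "is_path R C 0 p \<alpha>"
    unfolding is_path_def
  proof (intro conjI ballI)
    show "\<alpha> c \<in> R" "0 \<le> \<alpha> c" for c
      using lR l(1) \<open>0 \<in> R\<close> by (auto simp: \<alpha>_def)
    have "(\<Sum>c\<in>C. \<alpha> c *\<^sub>R fst c) = (\<Sum>k\<in>UNIV. \<alpha> (F k) *\<^sub>R fst (F k))"
      by (rule sum_C) (simp add: \<alpha>_def)
    then show "(\<Sum>c\<in>C. \<alpha> c *\<^sub>R fst c) = p - 0"
      by (simp add: \<alpha>_F l(2))
  qed
  have "path_cost C \<alpha> = (\<Sum>k\<in>UNIV. \<alpha> (F k) * snd (F k))"
    unfolding path_cost_def by (rule sum_C) (simp add: \<alpha>_def)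
  then have cost: "path_cost C \<alpha> = a \<bullet> p"
    by (simp add: \<alpha>_F ap)
  \<comment> \<open>Weak duality: applying \<open>a\<close> to the path and bounding it termwise by
    the weights uses that the coefficients are nonnegative.\<close>
  have lower: "a \<bullet> p \<le> path_cost C \<beta>" if "is_path R C 0 p \<beta>" for \<beta>
  proof -
    have "p = (\<Sum>c\<in>C. \<beta> c *\<^sub>R fst c)"
      using that by (simp add: is_path_def)
    then have "a \<bullet> p = (\<Sum>c\<in>C. \<beta> c * (a \<bullet> fst c))"
      by (simp add: inner_sum_right)
    also have "\<dots> \<le> path_cost C \<beta>"
      unfolding path_cost_def using that a(2)
      by (intro sum_mono mult_left_mono) (auto simp: is_path_def)
    finally show ?thesis .
  qed
  have \<Delta>: "Delta ?u k p = l k * Delta0 ?u" for k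
    unfolding l(2) by (rule Delta_sum)
  \<comment> \<open>The bound is attained by \<open>\<alpha>\<close>, so \<open>LEAST\<close>
    denotes a true minimum.\<close>
  have "chamfer_norm R C p = a \<bullet> p"
    unfolding chamfer_norm_def chamfer_dist_def
    using path cost lower by (intro Least_equality) auto
  also have "\<dots> = 1 / Delta0 ?u * (\<Sum>k\<in>UNIV. Delta ?u k p * snd (F k))"
    using Delta0_nonzero[OF indep]
    by (simp add: ap \<Delta> sum_distrib_left)
  finally show ?thesis .
qed

end
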